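(* Let $X\subset\mathbb{C}$ be a perfect, compact set and let $(M_n)_{n\ge 0}$ be a nonanalytic weight sequence. (a) Suppose $\phi\in D^\infty(X)$, $\phi(X)\subseteq X$, $\limsup_{k\to\infty}\left(\frac{\|\phi^{(k)}\|_\infty}{k!}\right)^{1/k}$ is finite and $\|\phi'\|_\infty<1$. Then $\phi$ induces an endomorphism of $D(X,M)$. (b) If, in addition to the hypotheses that $\phi\in D^\infty(X)$, $\phi(X)\subseteq X$ and $\limsup_{k\to\infty}\left(\frac{\|\phi^{(k)}\|_\infty}{k!}\right)^{1/k}<\infty$, there exists $B>0$ such that $\frac{M_m}{m!}\frac{n!}{M_n}\le\frac{B}{m^{n-m}}$ for all $n\ge m\ge 1$, and the sequence $\left\{\frac{\|\phi^{(k)}\|_\infty}{k!}\right\}_k$ is bounded, then $\|\phi'\|_\infty\le 1$ (in place of $\|\phi'\|_\infty<1$) is sufficient for $\phi$ to induce an endomorphism of $D(X,M)$.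
   Context: For a perfect compact set $X\subset\mathbb{C}$, a function $f:X\to\mathbb{C}$ is complex-differentiable at $a\in X$ if $f'(a)=\lim_{z\to a,\ z\in X}\frac{f(z)-f(a)}{z-a}$ exists; higher derivatives $f^{(n)}$ are defined by iteration, and $D^\infty(X)$ is the set of infinitely complex-differentiable functions on $X$. $\|\cdot\|_\infty$ is the sup norm over $X$. A weight sequence (algebra sequence) is a sequence $(M_n)_{n\ge0}$ of positive numbers with $M_0=1$ and $\binom{m+n}{n}\le\frac{M_{m+n}}{M_mM_n}$ for all $m,n\ge0$. It is nonanalytic if $\lim_{n\to\infty}(n!/M_n)^{1/n}=0$. Define $D(X,M)=\{f\in D^\infty(X):\|f\|_{D(X,M)}=\sum_{n=0}^\infty\frac{\|f^{(n)}\|_\infty}{M_n}<\infty\}$, a commutative normed algebra under pointwise operations (not necessarily complete). A map $\phi:X\to X$ induces an endomorphism of $D(X,M)$ if $f\circ\phi\in D(X,M)$ for all $f\in D(X,M)$. *)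

theory Defs
  imports "HOL-Analysis.Analysis"
begin

definition perfect_set :: "'a::topological_space set \<Rightarrow> bool" where
  "perfect_set X \<longleftrightarrow> closed X \<and> (\<forall>x\<in>X. x islimpt X)"

(* A function on X is represented by a total function. All notions below depend only on its
   values on X: the filter "at a within X" ignores everything outside X. *)

definition deriv_within :: "complex set \<Rightarrow> (complex \<Rightarrow> complex) \<Rightarrow> complex \<Rightarrow> complex" where
  "deriv_within X f a = (THE D. (f has_field_derivative D) (at a within X))"

lemma deriv_within_eqI:
  assumes "a islimpt X" "(f has_field_derivative D) (at a within X)"
  shows "deriv_within X f a = D"
proof -
  have "\<not> trivial_limit (at a within X)"
    using assms(1) by (simp add: trivial_limit_within)
  then have "E = D" if "(f has_field_derivative E) (at a within X)" for E
    using that assms(2) unfolding has_field_derivative_iff by (rule tendsto_unique)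
  with assms(2) show ?thesis
    unfolding deriv_within_def by (intro the_equality)
qed

abbreviation higher_deriv_within ::
    "complex set \<Rightarrow> nat \<Rightarrow> (complex \<Rightarrow> complex) \<Rightarrow> complex \<Rightarrow> complex" where
  "higher_deriv_within X n f \<equiv> (deriv_within X ^^ n) f"

definition D_infinity :: "complex set \<Rightarrow> (complex \<Rightarrow> complex) set" where
  "D_infinity X =
     {f. \<forall>n. \<forall>a\<in>X. higher_deriv_within X n f field_differentiable (at a within X)}"

(* Only meaningful for functions that are bounded on X; on a compact X this covers all
   derivatives of elements of D_infinity X, which are continuous on X. *)
definition sup_norm :: "complex set \<Rightarrow> (complex \<Rightarrow> complex) \<Rightarrow> real" where
  "sup_norm X f = (SUP x\<in>X. norm (f x))"

definition weight_sequence :: "(nat \<Rightarrow> real) \<Rightarrow> bool" where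
  "weight_sequence M \<longleftrightarrow>
     (\<forall>n. M n > 0) \<and> M 0 = 1 \<and>
     (\<forall>m n. real ((m + n) choose n) \<le> M (m + n) / (M m * M n))"

definition nonanalytic :: "(nat \<Rightarrow> real) \<Rightarrow> bool" where
  "nonanalytic M \<longleftrightarrow> (\<lambda>n. root n (fact n / M n)) \<longlonglongrightarrow> 0"

definition D_alg :: "complex set \<Rightarrow> (nat \<Rightarrow> real) \<Rightarrow> (complex \<Rightarrow> complex) set" where
  "D_alg X M =
     {f \<in> D_infinity X. summable (\<lambda>n. sup_norm X (higher_deriv_within X n f) / M n)}"

definition induces_endomorphism ::
    "complex set \<Rightarrow> (nat \<Rightarrow> real) \<Rightarrow> (complex \<Rightarrow> complex) \<Rightarrow> bool" where
  "induces_endomorphism X M \<phi> \<longleftrightarrow> \<phi> ` X \<subseteq> X \<and> (\<forall>f\<in>D_alg X M. f \<circ> \<phi> \<in> D_alg X M)"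

end

theory Submission
  imports Defs "HOL-Computational_Algebra.Formal_Power_Series"
begin

text \<open>
  Write \<open>P n = M n / n!\<close> and let \<open>\<psi>(t) = \<Sum>k\<ge>1. (\<parallel>\<phi>\<^sup>(\<^sup>k\<^sup>)\<parallel> / k!) t\<^sup>k = t \<chi>(t)\<close>, a formal power series with
  nonnegative coefficients. Iterating the Leibniz rule on \<open>(f \<circ> \<phi>)' = \<phi>' \<cdot> (f' \<circ> \<phi>)\<close> and comparing
  with the coefficient recursion that comes from \<open>(\<psi>\<^sup>m\<^sup>+\<^sup>1)' = (m + 1) \<psi>' \<psi>\<^sup>m\<close> gives the majorised form
  of Faa di Bruno's formula
  \<open>\<parallel>(f \<circ> \<phi>)\<^sup>(\<^sup>n\<^sup>)\<parallel> \<le> \<Sum>m\<le>n. \<parallel>f\<^sup>(\<^sup>m\<^sup>)\<parallel> (n! / m!) [t\<^sup>n] \<psi>(t)\<^sup>m\<close>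
  (lemma \<open>norm_comp_deriv_le\<close>). After division by \<open>M n\<close>, summation over \<open>n\<close> and exchange of the sums,
  \<open>\<phi>\<close> induces an endomorphism as soon as
  \<open>\<Sum>j. (P m / P (m + j)) [t\<^sup>j] \<chi>(t)\<^sup>m\<close> is bounded uniformly in \<open>m\<close>
  (lemma \<open>induces_endomorphism_if_bounded\<close>). If \<open>P m / P (m + j) \<le> K e\<^sup>j\<close> for all \<open>j\<close>, this sum is at most
  \<open>K \<chi>(e)\<^sup>m\<close>, and it remains to choose \<open>e\<close>.

  If \<open>\<parallel>\<phi>'\<parallel> < 1\<close>, then \<open>\<chi>(0) < 1\<close>; the limsup condition makes \<open>\<chi>\<close> converge near \<open>0\<close>, so \<open>\<chi>(e) \<le> 1\<close> for
  some \<open>e > 0\<close>. Supermultiplicativity of \<open>P\<close> gives \<open>P m / P (m + j) \<le> 1 / P j\<close>, which nonanalyticity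
  bounds by \<open>K e\<^sup>j\<close>.

  If \<open>\<parallel>\<phi>'\<parallel> \<le> 1\<close> and \<open>\<parallel>\<phi>\<^sup>(\<^sup>k\<^sup>)\<parallel> / k! \<le> A\<close>, the extra condition on \<open>M\<close> allows \<open>e = 1 / m\<close> with \<open>K = B\<close>, and
  \<open>\<chi>(1 / m)\<^sup>m \<le> (1 + 2 A / m)\<^sup>m \<le> exp (2 A)\<close> for \<open>m \<ge> 2\<close>. The two cases \<open>m \<le> 1\<close> follow from
  nonanalyticity with \<open>e = 1 / 2\<close>.
\<close>

unbundle no vec_syntax and fps_syntax

section \<open>Towers of derivatives on a perfect set\<close>

text \<open>
  Derivatives within a perfect set are unique, so a sequence of functions on \<open>X\<close>, each the derivative
  of the preceding one, is the sequence of higher derivatives of the first.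
\<close>

lemma deriv_within_tower:
  assumes X: "perfect_set X"
    and base: "\<And>x. x \<in> X \<Longrightarrow> h 0 x = f x"
    and step: "\<And>n x. x \<in> X \<Longrightarrow> (h n has_field_derivative h (Suc n) x) (at x within X)"
  shows "f \<in> D_infinity X"
    and "x \<in> X \<Longrightarrow> higher_deriv_within X n f x = h n x"
proof -
  have eq: "\<forall>x\<in>X. higher_deriv_within X n f x = h n x" for n
  proof (induction n)
    case 0
    then show ?case using base by simp
  next
    case (Suc n)
    have "higher_deriv_within X (Suc n) f x = h (Suc n) x" if "x \<in> X" for x
    proof -
      have "(higher_deriv_within X n f has_field_derivative h (Suc n) x) (at x within X)"
        using step[OF that, of n] by (rule has_field_derivative_transform_within[OF _ zero_less_one])
          (use Suc that in auto)
      then show ?thesis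
        using X that deriv_within_eqI unfolding perfect_set_def by simp
    qed
    then show ?case by blast
  qed
  then show "x \<in> X \<Longrightarrow> higher_deriv_within X n f x = h n x" by blast
  have "higher_deriv_within X n f field_differentiable (at x within X)" if "x \<in> X" for n x
  proof -
    have "(higher_deriv_within X n f has_field_derivative h (Suc n) x) (at x within X)"
      using step[OF that, of n] by (rule has_field_derivative_transform_within[OF _ zero_less_one])
        (use eq that in auto)
    then show ?thesis unfolding field_differentiable_def by blast
  qed
  then show "f \<in> D_infinity X" unfolding D_infinity_def by blast
qed

lemma D_infinity_has_field_derivative:
  assumes "perfect_set X" and "f \<in> D_infinity X" and "x \<in> X"
  shows "(higher_deriv_within X n f has_field_derivative higher_deriv_within X (Suc n) f x)
           (at x within X)"
proof -
  obtain D where D: "(higher_deriv_within X n f has_field_derivative D) (at x within X)"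
    using assms unfolding D_infinity_def field_differentiable_def by blast
  with assms have "higher_deriv_within X (Suc n) f x = D"
    using deriv_within_eqI unfolding perfect_set_def by simp
  with D show ?thesis by simp
qed

lemma bdd_above_higher_deriv_within:
  assumes "compact X" and "f \<in> D_infinity X"
  shows "bdd_above ((\<lambda>x. norm (higher_deriv_within X n f x)) ` X)"
proof -
  have "continuous_on X (higher_deriv_within X n f)"
    using assms(2) unfolding D_infinity_def continuous_on_eq_continuous_within
    by (auto intro: field_differentiable_imp_continuous_at)
  then have "compact ((\<lambda>x. norm (higher_deriv_within X n f x)) ` X)"
    by (intro compact_continuous_image continuous_intros assms(1))
  then show ?thesis by (intro bounded_imp_bdd_above compact_imp_bounded)
qed

lemma norm_le_sup_norm:
  assumes "compact X" and "f \<in> D_infinity X" and "x \<in> X"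
  shows "norm (higher_deriv_within X n f x) \<le> sup_norm X (higher_deriv_within X n f)"
  unfolding sup_norm_def
  by (intro cSUP_upper assms(3) bdd_above_higher_deriv_within[OF assms(1,2)])

lemma sup_norm_nonneg:
  assumes "compact X" and "f \<in> D_infinity X" and "X \<noteq> {}"
  shows "0 \<le> sup_norm X (higher_deriv_within X n f)"
  using assms norm_le_sup_norm[OF assms(1,2)] by (meson ex_in_conv norm_ge_zero order_trans)


section \<open>Higher derivatives of a composition\<close>

text \<open>The Pascal step that passes from the Leibniz sum of order \<open>n\<close> to that of order \<open>n + 1\<close>.\<close>

lemma sum_choose_Suc_Leibniz:
  fixes u v :: "nat \<Rightarrow> 'a::comm_semiring_1"
  shows "(\<Sum>i\<le>Suc n. of_nat (Suc n choose i) * (u i * v (Suc n - i))) =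
         (\<Sum>i\<le>n. of_nat (n choose i) * (u (Suc i) * v (n - i) + u i * v (Suc (n - i))))"
proof -
  have *: "(\<Sum>i\<le>n. of_nat (n choose i) * (u i * v (Suc (n - i)))) =
        u 0 * v (Suc n) + (\<Sum>i\<le>n. of_nat (n choose Suc i) * (u (Suc i) * v (n - i)))"
  proof -
    have "(\<Sum>i\<le>n. of_nat (n choose i) * (u i * v (Suc (n - i)))) =
          (\<Sum>i\<le>Suc n. of_nat (n choose i) * (u i * v (Suc n - i)))"
      by (simp add: Suc_diff_le binomial_eq_0)
    also have "\<dots> = u 0 * v (Suc n) + (\<Sum>i\<le>n. of_nat (n choose Suc i) * (u (Suc i) * v (n - i)))"
      by (subst sum.atMost_Suc_shift) simp
    finally show ?thesis .
  qed
  show ?thesis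
    unfolding distrib_left sum.distrib *
    by (subst sum.atMost_Suc_shift) (simp add: sum.distrib distrib_left distrib_right ac_simps)
qed

text \<open>
  For \<open>\<phi>\<close> and \<open>f\<close> in \<open>D_infinity X\<close> with \<open>\<phi> ` X \<subseteq> X\<close> and for \<open>x \<in> X\<close>,
  the value \<open>comp_deriv X \<phi> f n k x\<close> is the \<open>n\<close>-th derivative of \<open>f\<^sup>(\<^sup>k\<^sup>) \<circ> \<phi>\<close> at \<open>x\<close>. The recursion is
  the Leibniz rule applied to \<open>(f\<^sup>(\<^sup>k\<^sup>) \<circ> \<phi>)' = \<phi>' \<cdot> (f\<^sup>(\<^sup>k\<^sup>+\<^sup>1\<^sup>) \<circ> \<phi>)\<close>.
\<close>

fun comp_deriv ::
    "complex set \<Rightarrow> (complex \<Rightarrow> complex) \<Rightarrow> (complex \<Rightarrow> complex) \<Rightarrow> nat \<Rightarrow> nat \<Rightarrow> complex \<Rightarrow> complex" where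
  "comp_deriv X \<phi> f 0 k x = higher_deriv_within X k f (\<phi> x)"
| "comp_deriv X \<phi> f (Suc n) k x =
     (\<Sum>i\<le>n. of_nat (n choose i) *
        (higher_deriv_within X (Suc i) \<phi> x * comp_deriv X \<phi> f (n - i) (Suc k) x))"

lemma comp_deriv_has_field_derivative:
  assumes X: "perfect_set X" and \<phi>: "\<phi> \<in> D_infinity X" "\<phi> ` X \<subseteq> X"
    and f: "f \<in> D_infinity X" and x: "x \<in> X"
  shows "(comp_deriv X \<phi> f n k has_field_derivative comp_deriv X \<phi> f (Suc n) k x) (at x within X)"
proof (induction n arbitrary: k rule: less_induct)
  case (less n)
  show ?case
  proof (cases n)
    case 0
    have d\<phi>: "(\<phi> has_field_derivative higher_deriv_within X (Suc 0) \<phi> x) (at x within X)"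
      using D_infinity_has_field_derivative[OF X \<phi>(1) x, of 0] by simp
    have "(higher_deriv_within X k f has_field_derivative higher_deriv_within X (Suc k) f (\<phi> x))
            (at (\<phi> x) within \<phi> ` X)"
      using D_infinity_has_field_derivative[OF X f, of "\<phi> x" k] \<phi>(2) x
      by (blast intro: DERIV_subset)
    from DERIV_image_chain[OF this d\<phi>] show ?thesis
      by (simp add: 0 o_def mult.commute)
  next
    case (Suc p)
    define u where "u i = higher_deriv_within X (Suc i) \<phi> x" for i
    define v where "v j = comp_deriv X \<phi> f j (Suc k) x" for j
    have "((\<lambda>x. \<Sum>i\<le>p. of_nat (p choose i) *
            (higher_deriv_within X (Suc i) \<phi> x * comp_deriv X \<phi> f (p - i) (Suc k) x))
          has_field_derivative
            (\<Sum>i\<le>p. of_nat (p choose i) * (u (Suc i) * v (p - i) + u i * v (Suc (p - i)))))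
          (at x within X)"
    proof (intro DERIV_sum DERIV_cmult)
      fix i assume "i \<in> {..p}"
      have 1: "(higher_deriv_within X (Suc i) \<phi> has_field_derivative u (Suc i)) (at x within X)"
        unfolding u_def by (rule D_infinity_has_field_derivative[OF X \<phi>(1) x])
      have 2: "(comp_deriv X \<phi> f (p - i) (Suc k) has_field_derivative v (Suc (p - i))) (at x within X)"
        unfolding v_def by (rule less) (simp add: Suc)
      show "((\<lambda>x. higher_deriv_within X (Suc i) \<phi> x * comp_deriv X \<phi> f (p - i) (Suc k) x)
          has_field_derivative u (Suc i) * v (p - i) + u i * v (Suc (p - i))) (at x within X)"
        using DERIV_mult[OF 1 2] by (simp add: u_def v_def ac_simps)
    qed
    moreover have "comp_deriv X \<phi> f (Suc n) k x =
        (\<Sum>i\<le>p. of_nat (p choose i) * (u (Suc i) * v (p - i) + u i * v (Suc (p - i))))"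
      unfolding sum_choose_Suc_Leibniz[symmetric]
      by (simp only: Suc comp_deriv.simps(2) u_def v_def)
    moreover have "comp_deriv X \<phi> f n k = (\<lambda>x. \<Sum>i\<le>p. of_nat (p choose i) *
            (higher_deriv_within X (Suc i) \<phi> x * comp_deriv X \<phi> f (p - i) (Suc k) x))"
      by (rule ext) (simp only: Suc comp_deriv.simps(2))
    ultimately show ?thesis by simp
  qed
qed

lemma D_infinity_compose:
  assumes "perfect_set X" and "\<phi> \<in> D_infinity X" "\<phi> ` X \<subseteq> X" and "f \<in> D_infinity X"
  shows "f \<circ> \<phi> \<in> D_infinity X"
    and "x \<in> X \<Longrightarrow> higher_deriv_within X n (f \<circ> \<phi>) x = comp_deriv X \<phi> f n 0 x"
  using deriv_within_tower[of X "\<lambda>n. comp_deriv X \<phi> f n 0" "f \<circ> \<phi>"]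
    comp_deriv_has_field_derivative[OF assms] assms(1) by auto


section \<open>Majorising the derivatives by coefficients of powers\<close>

text \<open>
  The \<open>j\<close>-th coefficient is \<open>\<parallel>\<phi>\<^sup>(\<^sup>j\<^sup>+\<^sup>1\<^sup>)\<parallel>\<^sub>\<infinity> / (j + 1)!\<close>, so that \<open>fps_X * majorant X \<phi>\<close> is the Taylor series
  with coefficients \<open>\<parallel>\<phi>\<^sup>(\<^sup>k\<^sup>)\<parallel>\<^sub>\<infinity> / k!\<close> and without constant term.
\<close>

definition majorant :: "complex set \<Rightarrow> (complex \<Rightarrow> complex) \<Rightarrow> real fps" where
  "majorant X \<phi> = Abs_fps (\<lambda>j. sup_norm X (higher_deriv_within X (Suc j) \<phi>) / fact (Suc j))"

text \<open>Comparison of coefficients in \<open>(F\<^sup>m\<^sup>+\<^sup>1)' = (m + 1) F' F\<^sup>m\<close>.\<close>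

lemma fps_power_Suc_nth_Suc:
  fixes F :: "'a::field_char_0 fps"
  shows "of_nat (Suc n) * (F ^ Suc m) $ Suc n =
         of_nat (Suc m) * (\<Sum>i\<le>n. of_nat (Suc i) * F $ Suc i * (F ^ m) $ (n - i))"
proof -
  have "of_nat (Suc n) * (F ^ Suc m) $ Suc n = fps_deriv (F ^ Suc m) $ n"
    by (simp only: fps_deriv_nth Suc_eq_plus1)
  also have "fps_deriv (F ^ Suc m) = fps_const (of_nat (Suc m)) * (fps_deriv F * F ^ m)"
    by (simp add: fps_deriv_power' ac_simps flip: fps_of_nat del: power_Suc)
  also have "\<dots> $ n = of_nat (Suc m) * (\<Sum>i\<le>n. of_nat (Suc i) * F $ Suc i * (F ^ m) $ (n - i))"
    unfolding fps_mult_left_const_nth by (simp add: fps_mult_nth atLeast0AtMost)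
  finally show ?thesis .
qed

text \<open>
  Faa di Bruno's formula with absolute values. The summand \<open>m\<close> involves the partial Bell polynomial
  \<open>B\<^sub>n\<^sub>,\<^sub>m\<close> evaluated at the numbers \<open>\<parallel>\<phi>\<^sup>(\<^sup>k\<^sup>)\<parallel>\<^sub>\<infinity>\<close>, in the form \<open>n! / m!\<close> times the \<open>n\<close>-th coefficient of
  \<open>\<psi>\<^sup>m\<close>. The index \<open>k\<close> is general because the induction raises the order of the derivative of \<open>f\<close>.
\<close>

lemma norm_comp_deriv_le:
  assumes X: "compact X" and \<phi>: "\<phi> \<in> D_infinity X" "\<phi> ` X \<subseteq> X"
    and f: "f \<in> D_infinity X" and x: "x \<in> X"
  defines "\<psi> \<equiv> fps_X * majorant X \<phi>"
  shows "norm (comp_deriv X \<phi> f n k x) \<le>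
    (\<Sum>m\<le>n. sup_norm X (higher_deriv_within X (m + k) f) * (fact n / fact m * (\<psi> ^ m) $ n))"
proof (induction n arbitrary: k rule: less_induct)
  case (less n)
  define F where "F m = sup_norm X (higher_deriv_within X m f)" for m
  define A where "A m = sup_norm X (higher_deriv_within X m \<phi>)" for m
  have A0: "A m \<ge> 0" for m
    unfolding A_def using sup_norm_nonneg[OF X \<phi>(1)] x by blast
  have \<psi>: "\<psi> $ Suc i = A (Suc i) / fact (Suc i)" for i
    by (simp add: \<psi>_def majorant_def A_def)
  show ?case
  proof (cases n)
    case 0
    then show ?thesis
      using norm_le_sup_norm[OF X f, of "\<phi> x" k] \<phi>(2) x by auto
  next
    case (Suc p)
    have "norm (comp_deriv X \<phi> f n k x) \<le> (\<Sum>i\<le>p. norm (of_nat (p choose i) *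
        (higher_deriv_within X (Suc i) \<phi> x * comp_deriv X \<phi> f (p - i) (Suc k) x)))"
      unfolding Suc comp_deriv.simps(2) by (rule norm_sum)
    also have "\<dots> \<le> (\<Sum>i\<le>p. real (p choose i) * (A (Suc i) *
        (\<Sum>m\<le>p. F (m + Suc k) * (fact (p - i) / fact m * (\<psi> ^ m) $ (p - i)))))"
    proof (rule sum_mono)
      fix i assume i: "i \<in> {..p}"
      have "norm (comp_deriv X \<phi> f (p - i) (Suc k) x) \<le>
          (\<Sum>m\<le>p - i. F (m + Suc k) * (fact (p - i) / fact m * (\<psi> ^ m) $ (p - i)))"
        unfolding F_def by (rule less) (simp add: Suc)
      \<comment> \<open>For \<open>m > p - i\<close> the coefficient vanishes, as \<open>\<psi>\<close> has no constant term.\<close>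
      also have "\<dots> = (\<Sum>m\<le>p. F (m + Suc k) * (fact (p - i) / fact m * (\<psi> ^ m) $ (p - i)))"
        by (rule sum.mono_neutral_left)
          (auto simp: \<psi>_def power_mult_distrib fps_X_power_mult_nth)
      finally show "norm (of_nat (p choose i) *
          (higher_deriv_within X (Suc i) \<phi> x * comp_deriv X \<phi> f (p - i) (Suc k) x)) \<le>
        real (p choose i) * (A (Suc i) *
          (\<Sum>m\<le>p. F (m + Suc k) * (fact (p - i) / fact m * (\<psi> ^ m) $ (p - i))))"
        unfolding norm_mult norm_of_nat
        using norm_le_sup_norm[OF X \<phi>(1) x, of "Suc i"] A0
        by (intro mult_left_mono mult_mono) (auto simp: A_def simp del: funpow.simps)
    qed
    also have "\<dots> = (\<Sum>i\<le>p. \<Sum>m\<le>p. F (Suc m + k) * (fact p / fact m *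
        (real (Suc i) * \<psi> $ Suc i * (\<psi> ^ m) $ (p - i))))"
      unfolding sum_distrib_left
    proof (intro sum.cong refl)
      fix i m assume "i \<in> {..p}"
      then have 1: "real (p choose i) * fact (p - i) = fact p / fact i"
        by (simp add: binomial_fact)
      have 2: "real (Suc i) * \<psi> $ Suc i = A (Suc i) / fact i"
        by (simp add: \<psi> del: of_nat_Suc)
      have "real (p choose i) * (A (Suc i) *
            (F (m + Suc k) * (fact (p - i) / fact m * (\<psi> ^ m) $ (p - i)))) =
          (real (p choose i) * fact (p - i)) *
            (A (Suc i) * F (m + Suc k) * (\<psi> ^ m) $ (p - i) / fact m)"
        by simp
      then show "real (p choose i) * (A (Suc i) *
            (F (m + Suc k) * (fact (p - i) / fact m * (\<psi> ^ m) $ (p - i)))) =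
          F (Suc m + k) * (fact p / fact m * (real (Suc i) * \<psi> $ Suc i * (\<psi> ^ m) $ (p - i)))"
        unfolding 1 2 by (simp add: ac_simps)
    qed
    also have "\<dots> = (\<Sum>m\<le>p. F (Suc m + k) * (fact p / fact m *
        (\<Sum>i\<le>p. real (Suc i) * \<psi> $ Suc i * (\<psi> ^ m) $ (p - i))))"
      unfolding sum_distrib_left by (rule sum.swap)
    also have "\<dots> = (\<Sum>m\<le>p. F (Suc m + k) * (fact (Suc p) / fact (Suc m) * (\<psi> ^ Suc m) $ Suc p))"
    proof (intro sum.cong refl)
      fix m
      have "(\<Sum>i\<le>p. real (Suc i) * \<psi> $ Suc i * (\<psi> ^ m) $ (p - i)) =
          real (Suc p) / real (Suc m) * (\<psi> ^ Suc m) $ Suc p"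
        using fps_power_Suc_nth_Suc[of p \<psi> m] by (simp add: field_simps del: power_Suc of_nat_Suc)
      then show "F (Suc m + k) * (fact p / fact m *
            (\<Sum>i\<le>p. real (Suc i) * \<psi> $ Suc i * (\<psi> ^ m) $ (p - i))) =
          F (Suc m + k) * (fact (Suc p) / fact (Suc m) * (\<psi> ^ Suc m) $ Suc p)"
        by (simp only: fact_Suc) (simp add: field_simps del: power_Suc of_nat_Suc)
    qed
    also have "\<dots> = (\<Sum>m\<le>n. F (m + k) * (fact n / fact m * (\<psi> ^ m) $ n))"
      unfolding Suc by (subst sum.atMost_Suc_shift) simp
    finally show ?thesis unfolding F_def .
  qed
qed


section \<open>A criterion for inducing an endomorphism\<close>

text \<open>
  Summing the majorants against \<open>1 / M n\<close> and exchanging the two sums leaves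
  the factor \<open>K\<close> in front of the norm of \<open>f\<close>.
\<close>

lemma induces_endomorphism_if_bounded:
  assumes X: "perfect_set X" "compact X" and M: "\<And>n. M n > 0"
    and \<phi>: "\<phi> \<in> D_infinity X" "\<phi> ` X \<subseteq> X"
    and bound: "\<And>m N. (\<Sum>j\<le>N. (M m / fact m) * (fact (m + j) / M (m + j)) *
                          (majorant X \<phi> ^ m) $ j) \<le> K"
  shows "induces_endomorphism X M \<phi>"
  unfolding induces_endomorphism_def
proof (intro conjI ballI \<phi>(2))
  fix f assume "f \<in> D_alg X M"
  then have f: "f \<in> D_infinity X"
    and sumf: "summable (\<lambda>n. sup_norm X (higher_deriv_within X n f) / M n)"
    by (auto simp: D_alg_def)
  note comp = D_infinity_compose[OF X(1) \<phi> f]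
  have "summable (\<lambda>n. sup_norm X (higher_deriv_within X n (f \<circ> \<phi>)) / M n)"
  proof (cases "X = {}")
    case True
    \<comment> \<open>On the empty set all values of \<open>sup_norm\<close> coincide, with the supremum of the empty set.\<close>
    then show ?thesis using sumf by (simp add: sup_norm_def)
  next
    case False
    define F where "F m = sup_norm X (higher_deriv_within X m f)" for m
    define w where "w m n = (M m / fact m) * (fact n / M n) * ((fps_X * majorant X \<phi>) ^ m) $ n"
      for m n
    have F0: "F m \<ge> 0" for m
      unfolding F_def by (rule sup_norm_nonneg[OF X(2) f False])
    have le: "sup_norm X (higher_deriv_within X n (f \<circ> \<phi>)) / M n \<le> (\<Sum>m\<le>n. F m / M m * w m n)" for n
    proof -
      have "sup_norm X (higher_deriv_within X n (f \<circ> \<phi>)) \<le>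
          (\<Sum>m\<le>n. F m * (fact n / fact m * ((fps_X * majorant X \<phi>) ^ m) $ n))"
        unfolding sup_norm_def
      proof (rule cSUP_least[OF False])
        fix x assume "x \<in> X"
        then show "norm (higher_deriv_within X n (f \<circ> \<phi>) x) \<le>
            (\<Sum>m\<le>n. F m * (fact n / fact m * ((fps_X * majorant X \<phi>) ^ m) $ n))"
          using norm_comp_deriv_le[OF X(2) \<phi> f, of x n 0] comp(2) by (simp add: F_def)
      qed
      then have "sup_norm X (higher_deriv_within X n (f \<circ> \<phi>)) / M n \<le>
          (\<Sum>m\<le>n. F m * (fact n / fact m * ((fps_X * majorant X \<phi>) ^ m) $ n)) / M n"
        using M by (simp add: divide_right_mono less_imp_le)
      also have "\<dots> = (\<Sum>m\<le>n. F m / M m * w m n)"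
        unfolding sum_divide_distrib w_def using M[THEN less_imp_neq]
        by (intro sum.cong refl) (simp add: field_simps)
      finally show ?thesis .
    qed
    have wsum: "(\<Sum>n\<le>N. w m n) \<le> K" if "m \<le> N" for m N
    proof -
      have "(\<Sum>n\<le>N. w m n) = (\<Sum>n=m..N. w m n)"
        by (rule sum.mono_neutral_right)
          (auto simp: w_def power_mult_distrib fps_X_power_mult_nth)
      also have "\<dots> = (\<Sum>j\<le>N - m. w m (m + j))"
        using that by (intro sum.reindex_bij_witness[of _ "\<lambda>j. m + j" "\<lambda>n. n - m"]) auto
      also have "\<dots> \<le> K"
        using bound[of m "N - m"] by (simp add: w_def power_mult_distrib fps_X_power_mult_nth)
      finally show ?thesis .
    qed
    show ?thesis
    proof (rule bounded_imp_summable)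
      fix n
      show "0 \<le> sup_norm X (higher_deriv_within X n (f \<circ> \<phi>)) / M n"
        using sup_norm_nonneg[OF X(2) comp(1) False] M by (simp add: less_imp_le)
    next
      fix N
      have "(\<Sum>n\<le>N. sup_norm X (higher_deriv_within X n (f \<circ> \<phi>)) / M n)
          \<le> (\<Sum>n\<le>N. \<Sum>m\<le>n. F m / M m * w m n)"
        by (intro sum_mono le)
      also have "\<dots> = (\<Sum>n\<le>N. \<Sum>m\<le>N. F m / M m * w m n)"
        by (intro sum.cong refl sum.mono_neutral_left)
          (auto simp: w_def power_mult_distrib fps_X_power_mult_nth)
      also have "\<dots> = (\<Sum>m\<le>N. F m / M m * (\<Sum>n\<le>N. w m n))"
        unfolding sum_distrib_left by (rule sum.swap)
      also have "\<dots> \<le> (\<Sum>m\<le>N. F m / M m * K)"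
        using wsum F0 M by (intro sum_mono mult_left_mono) (auto simp: less_imp_le)
      also have "\<dots> = K * (\<Sum>m\<le>N. F m / M m)"
        by (simp add: sum_distrib_left mult.commute)
      also have "\<dots> \<le> K * (\<Sum>m. F m / M m)"
      proof (rule mult_left_mono)
        show "(\<Sum>m\<le>N. F m / M m) \<le> (\<Sum>m. F m / M m)"
          using sumf F0 M unfolding F_def by (intro sum_le_suminf) (auto simp: less_imp_le)
        show "0 \<le> K" using bound[of 0 0] M[of 0] by simp
      qed
      finally show "(\<Sum>n\<le>N. sup_norm X (higher_deriv_within X n (f \<circ> \<phi>)) / M n)
          \<le> K * (\<Sum>m. F m / M m)" .
    qed
  qed
  with comp(1) show "f \<circ> \<phi> \<in> D_alg X M" by (simp add: D_alg_def)
qed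


section \<open>Estimates for the coefficient sums\<close>

text \<open>
  The next two lemmas are evaluation of products and powers at \<open>e\<close>. They are stated for partial
  sums, where nonnegativity of the coefficients replaces equality by an inequality.
\<close>

lemma sum_fps_mult_nth_le:
  fixes F G :: "real fps"
  assumes F: "\<And>i. F $ i \<ge> 0" and G: "\<And>i. G $ i \<ge> 0" and e: "e \<ge> 0"
  shows "(\<Sum>j\<le>N. (F * G) $ j * e ^ j) \<le> (\<Sum>j\<le>N. F $ j * e ^ j) * (\<Sum>j\<le>N. G $ j * e ^ j)"
proof -
  have "(\<Sum>j\<le>N. (F * G) $ j * e ^ j) = (\<Sum>j\<le>N. \<Sum>i\<le>j. (F $ i * e ^ i) * (G $ (j - i) * e ^ (j - i)))"
    by (intro sum.cong refl)
      (simp add: fps_mult_nth atLeast0AtMost sum_distrib_left ac_simps flip: power_add)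
  also have "\<dots> = (\<Sum>(i, k) \<in> {(i, k). i + k \<le> N}. (F $ i * e ^ i) * (G $ k * e ^ k))"
    by (rule sum.triangle_reindex_eq[symmetric])
  also have "\<dots> \<le> (\<Sum>(i, k) \<in> {..N} \<times> {..N}. (F $ i * e ^ i) * (G $ k * e ^ k))"
    using assms by (intro sum_mono2) auto
  also have "\<dots> = (\<Sum>j\<le>N. F $ j * e ^ j) * (\<Sum>j\<le>N. G $ j * e ^ j)"
    by (simp add: sum_product sum.cartesian_product)
  finally show ?thesis .
qed

lemma sum_fps_power_nth_le:
  fixes F :: "real fps"
  assumes F: "\<And>i. F $ i \<ge> 0" and e: "e \<ge> 0" and s: "\<And>N. (\<Sum>j\<le>N. F $ j * e ^ j) \<le> s"
  shows "(\<forall>j. (F ^ m) $ j \<ge> 0) \<and> (\<Sum>j\<le>N. (F ^ m) $ j * e ^ j) \<le> s ^ m"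
proof (induction m)
  case 0
  have "(\<Sum>j\<le>N. (1 :: real fps) $ j * e ^ j) = 1"
    by (simp add: fps_one_nth if_distrib[of "\<lambda>c. c * _"] sum.delta cong: if_cong)
  then show ?case by simp
next
  case (Suc m)
  have "0 \<le> s" using s[of 0] F[of 0] by simp
  have "(\<Sum>j\<le>N. (F ^ Suc m) $ j * e ^ j) \<le>
      (\<Sum>j\<le>N. F $ j * e ^ j) * (\<Sum>j\<le>N. (F ^ m) $ j * e ^ j)"
    unfolding power_Suc using F Suc e by (intro sum_fps_mult_nth_le) auto
  also have "\<dots> \<le> s * s ^ m"
    using s Suc F e \<open>0 \<le> s\<close> by (intro mult_mono sum_nonneg) auto
  finally show ?case
    using F Suc by (auto simp: fps_mult_nth intro!: sum_nonneg)
qed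

text \<open>The constant \<open>D\<close> absorbs the finitely many indices at which the bound on the roots may fail.\<close>

lemma le_geometric_if_root_le:
  fixes u :: "nat \<Rightarrow> real"
  assumes c: "c > 0" and u: "\<forall>\<^sub>F k in sequentially. root k (u k) \<le> c"
  obtains D where "D > 0" "\<And>k. u k \<le> D * c ^ k"
proof -
  obtain N where N: "\<And>k. k \<ge> N \<Longrightarrow> root k (u k) \<le> c"
    using u unfolding eventually_sequentially by blast
  define D where "D = 1 + (\<Sum>k\<le>N. \<bar>u k\<bar> / c ^ k)"
  have D: "D \<ge> 1" unfolding D_def using c by (simp add: sum_nonneg)
  have "u k \<le> D * c ^ k" for k
  proof (cases "k \<le> N")
    case True
    have "\<bar>u k\<bar> / c ^ k \<le> (\<Sum>k\<le>N. \<bar>u k\<bar> / c ^ k)"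
      using True c by (intro member_le_sum) auto
    then have "\<bar>u k\<bar> / c ^ k \<le> D" by (simp add: D_def)
    then have "\<bar>u k\<bar> \<le> D * c ^ k" using c by (simp add: field_simps)
    then show ?thesis by linarith
  next
    case False
    then have "root k (u k) \<le> root k (c ^ k)"
      using N[of k] c by (simp add: real_root_power_cancel)
    then have "u k \<le> c ^ k" using False by simp
    also have "\<dots> \<le> D * c ^ k" using D c by simp
    finally show ?thesis .
  qed
  with D show ?thesis by (intro that[of D]) auto
qed

text \<open>The defining inequality of a weight sequence says that \<open>M n / n!\<close> is supermultiplicative.\<close>

lemma weight_sequence_ratio_le:
  assumes "weight_sequence M"
  shows "(M m / fact m) * (fact (m + j) / M (m + j)) \<le> fact j / M j"
proof -
  have pos: "M n > 0" for n using assms by (simp add: weight_sequence_def)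
  have "real ((m + j) choose j) \<le> M (m + j) / (M m * M j)"
    using assms by (simp add: weight_sequence_def)
  then have "fact (m + j) / (fact m * fact j) \<le> M (m + j) / (M m * M j)"
    by (simp add: binomial_fact mult.commute)
  then show ?thesis using pos[of m] pos[of j] pos[of "m + j"] by (simp add: field_simps)
qed

lemma nonanalytic_geometric_bound:
  assumes "nonanalytic M" and "e > 0"
  obtains K where "K > 0" "\<And>n. fact n / M n \<le> K * e ^ n"
proof -
  have "\<forall>\<^sub>F n in sequentially. root n (fact n / M n) < e"
    using assms by (auto simp: nonanalytic_def intro: order_tendstoD)
  then have "\<forall>\<^sub>F n in sequentially. root n (fact n / M n) \<le> e"
    by eventually_elim simp
  from le_geometric_if_root_le[OF \<open>e > 0\<close> this] show ?thesis using that by blast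
qed

lemma weighted_majorant_power_sum_le:
  assumes F: "\<And>i. F $ i \<ge> 0" and e: "e \<ge> 0" and s: "\<And>N. (\<Sum>j\<le>N. F $ j * e ^ j) \<le> s"
    and K: "K \<ge> 0" and r: "\<And>j. r j \<le> K * e ^ j"
  shows "(\<Sum>j\<le>N. r j * ((F :: real fps) ^ m) $ j) \<le> K * s ^ m"
proof -
  note * = sum_fps_power_nth_le[OF F e s, of m]
  have "(\<Sum>j\<le>N. r j * (F ^ m) $ j) \<le> (\<Sum>j\<le>N. K * e ^ j * (F ^ m) $ j)"
    using * r by (intro sum_mono mult_right_mono) auto
  also have "\<dots> = K * (\<Sum>j\<le>N. (F ^ m) $ j * e ^ j)"
    by (simp add: sum_distrib_left ac_simps)
  also have "\<dots> \<le> K * s ^ m" using * K by (intro mult_left_mono) auto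
  finally show ?thesis .
qed

lemma sum_power_atMost_le:
  fixes F :: "nat \<Rightarrow> real"
  assumes e: "0 < e" and c: "0 < c" "c * e \<le> 1 / 2" and A: "0 \<le> A"
    and F: "\<And>k. F (Suc k) \<le> A * c ^ Suc k" and "F 0 \<le> a"
  shows "(\<Sum>j\<le>N. F j * e ^ j) \<le> a + 2 * A * (c * e)"
proof -
  define q where "q = c * e"
  have q: "0 < q" "q \<le> 1 / 2" using assms by (auto simp: q_def)
  have "(\<Sum>j\<le>N. F j * e ^ j) = F 0 + (\<Sum>j<N. F (Suc j) * e ^ Suc j)"
    by (simp add: sum.atMost_shift)
  also have "(\<Sum>j<N. F (Suc j) * e ^ Suc j) \<le> (\<Sum>j<N. (A * c ^ Suc j) * e ^ Suc j)"
    using F e by (intro sum_mono mult_right_mono) auto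
  also have "\<dots> = A * q * (\<Sum>j<N. q ^ j)"
    by (simp add: sum_distrib_left q_def power_mult_distrib ac_simps)
  also have "\<dots> \<le> A * q * 2"
  proof (rule mult_left_mono)
    have "(\<Sum>j<N. q ^ j) \<le> (\<Sum>j. q ^ j)"
      using q by (intro sum_le_suminf summable_geometric) auto
    also have "\<dots> = 1 / (1 - q)" using q by (intro suminf_geometric) auto
    also have "\<dots> \<le> 2" using q by (simp add: field_simps)
    finally show "(\<Sum>j<N. q ^ j) \<le> 2" .
  qed (use A q in auto)
  finally show ?thesis using \<open>F 0 \<le> a\<close> by (simp add: q_def ac_simps)
qed


section \<open>Self-maps whose derivative is bounded by one\<close>

lemma majorant_nth_nonneg:
  assumes "compact X" and "\<phi> \<in> D_infinity X" and "X \<noteq> {}"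
  shows "majorant X \<phi> $ j \<ge> 0"
  using sup_norm_nonneg[OF assms, of "Suc j"] by (simp add: majorant_def)

lemma majorant_nth_0: "majorant X \<phi> $ 0 = sup_norm X (deriv_within X \<phi>)"
  by (simp add: majorant_def)

lemma induces_endomorphism_empty: "induces_endomorphism {} M \<phi>"
  by (simp add: induces_endomorphism_def D_alg_def D_infinity_def sup_norm_def)

lemma induces_endomorphism_of_deriv_less_1:
  assumes X: "perfect_set X" "compact X" and M: "weight_sequence M" "nonanalytic M"
    and \<phi>: "\<phi> \<in> D_infinity X" "\<phi> ` X \<subseteq> X"
    and lim: "limsup (\<lambda>k. ereal (root k (sup_norm X (higher_deriv_within X k \<phi>) / fact k))) < \<infinity>"
    and less: "sup_norm X (deriv_within X \<phi>) < 1"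
  shows "induces_endomorphism X M \<phi>"
proof (cases "X = {}")
  case True
  then show ?thesis by (simp add: induces_endomorphism_empty)
next
  case False
  define a where "a = sup_norm X (deriv_within X \<phi>)"
  obtain b :: real where b:
    "limsup (\<lambda>k. ereal (root k (sup_norm X (higher_deriv_within X k \<phi>) / fact k))) < ereal b"
    using lim ereal_dense2 by blast
  define c where "c = max b 1"
  have c: "c > 0" "b \<le> c" by (auto simp: c_def)
  have ev: "\<forall>\<^sub>F k in sequentially. root k (sup_norm X (higher_deriv_within X k \<phi>) / fact k) \<le> c"
    using Limsup_lessD[OF b] by eventually_elim (use c in auto)
  then obtain D where D: "D > 0" "\<And>k. sup_norm X (higher_deriv_within X k \<phi>) / fact k \<le> D * c ^ k"
    using le_geometric_if_root_le[OF c(1) ev] by blast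
  \<comment> \<open>Small enough that \<open>a + 2 D c (c e) \<le> 1\<close> and that the geometric ratio \<open>c e\<close> is at most \<open>1 / 2\<close>.\<close>
  define e where "e = min (1 / (2 * c)) ((1 - a) / (2 * D * c * c))"
  have e: "e > 0" using c D less by (simp add: e_def a_def)
  have "e \<le> 1 / (2 * c)" "e \<le> (1 - a) / (2 * D * c * c)" by (auto simp: e_def)
  then have ce: "c * e \<le> 1 / 2" "2 * (D * c) * (c * e) \<le> 1 - a"
    using c(1) D(1) by (auto simp: field_simps)
  obtain K where K: "K > 0" "\<And>n. fact n / M n \<le> K * e ^ n"
    using nonanalytic_geometric_bound[OF M(2) e] by blast
  have s: "(\<Sum>j\<le>N. majorant X \<phi> $ j * e ^ j) \<le> 1" for N
  proof -
    have "(\<Sum>j\<le>N. majorant X \<phi> $ j * e ^ j) \<le> a + 2 * (D * c) * (c * e)"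
    proof (rule sum_power_atMost_le[OF e c(1) ce(1)])
      show "majorant X \<phi> $ Suc k \<le> D * c * c ^ Suc k" for k
        using D(2)[of "Suc (Suc k)"] by (simp add: majorant_def ac_simps)
    qed (use D c in \<open>auto simp: majorant_nth_0 a_def\<close>)
    then show ?thesis using ce(2) by linarith
  qed
  show ?thesis
  proof (rule induces_endomorphism_if_bounded[OF X _ \<phi>])
    show "M n > 0" for n using M(1) by (simp add: weight_sequence_def)
    fix m N
    have "(\<Sum>j\<le>N. (M m / fact m) * (fact (m + j) / M (m + j)) * (majorant X \<phi> ^ m) $ j) \<le> K * 1 ^ m"
      by (rule weighted_majorant_power_sum_le[OF majorant_nth_nonneg[OF X(2) \<phi>(1) False] _ s])
        (use e K weight_sequence_ratio_le[OF M(1)] in \<open>auto intro: order_trans\<close>)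
    then show "(\<Sum>j\<le>N. (M m / fact m) * (fact (m + j) / M (m + j)) * (majorant X \<phi> ^ m) $ j) \<le> K"
      by simp
  qed
qed

lemma induces_endomorphism_of_deriv_le_1:
  assumes X: "perfect_set X" "compact X" and M: "weight_sequence M" "nonanalytic M"
    and \<phi>: "\<phi> \<in> D_infinity X" "\<phi> ` X \<subseteq> X"
    and B: "B > 0" "\<And>m n. 1 \<le> m \<Longrightarrow> m \<le> n \<Longrightarrow>
               (M m / fact m) * (fact n / M n) \<le> B / real m ^ (n - m)"
    and bdd: "bounded (range (\<lambda>k. sup_norm X (higher_deriv_within X k \<phi>) / fact k))"
    and le: "sup_norm X (deriv_within X \<phi>) \<le> 1"
  shows "induces_endomorphism X M \<phi>"
proof (cases "X = {}")
  case True
  then show ?thesis by (simp add: induces_endomorphism_empty)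
next
  case False
  obtain A where A: "A > 0" "\<And>k. sup_norm X (higher_deriv_within X k \<phi>) / fact k \<le> A"
  proof -
    obtain A where "A > 0"
      "\<forall>y\<in>range (\<lambda>k. sup_norm X (higher_deriv_within X k \<phi>) / fact k). norm y \<le> A"
      using bdd unfolding bounded_pos by blast
    then show ?thesis
      by (intro that[of A]) (auto simp: abs_le_iff)
  qed
  have s: "(\<Sum>j\<le>N. majorant X \<phi> $ j * e ^ j) \<le> 1 + 2 * A * e" if "0 < e" "e \<le> 1 / 2" for N e
  proof -
    have "majorant X \<phi> $ Suc k \<le> A * 1 ^ Suc k" for k
      using A(2)[of "Suc (Suc k)"] by (simp add: majorant_def)
    then show ?thesis
      using sum_power_atMost_le[of e 1 A "fps_nth (majorant X \<phi>)" 1 N] that A(1) le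
      by (simp add: majorant_nth_0)
  qed
  obtain K where K: "K > 0" "\<And>n. fact n / M n \<le> K * (1 / 2) ^ n"
    using nonanalytic_geometric_bound[OF M(2), of "1 / 2"] by auto
  show ?thesis
  proof (rule induces_endomorphism_if_bounded[OF X _ \<phi>])
    show "M n > 0" for n using M(1) by (simp add: weight_sequence_def)
    fix m N
    let ?S = "\<Sum>j\<le>N. (M m / fact m) * (fact (m + j) / M (m + j)) * (majorant X \<phi> ^ m) $ j"
    note sum_le = weighted_majorant_power_sum_le[OF majorant_nth_nonneg[OF X(2) \<phi>(1) False] _ s]
    show "?S \<le> max (K * (1 + A)) (B * exp (2 * A))"
    proof (cases "m \<le> 1")
      case True
      have "?S \<le> K * (1 + 2 * A * (1 / 2)) ^ m"
        by (rule sum_le) (use K weight_sequence_ratio_le[OF M(1)] in \<open>auto intro: order_trans\<close>)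
      also have "\<dots> = K * (1 + A) ^ m" by simp
      also have "\<dots> \<le> K * (1 + A) ^ 1"
        using True K A by (intro mult_left_mono power_increasing) auto
      finally show ?thesis by simp
    next
      case False
      have "?S \<le> B * (1 + 2 * A * (1 / real m)) ^ m"
      proof (rule sum_le)
        show "(M m / fact m) * (fact (m + j) / M (m + j)) \<le> B * (1 / real m) ^ j" for j
          using B(2)[of m "m + j"] False by (simp add: power_divide)
      qed (use False B in auto)
      also have "\<dots> \<le> B * exp (2 * A * (1 / real m)) ^ m"
        using A B by (intro mult_left_mono power_mono exp_ge_add_one_self) auto
      also have "\<dots> = B * exp (2 * A)"
        using False by (simp flip: exp_of_nat_mult)
      finally show ?thesis by simp
    qed
  qed
qed

theorem theorem1:
  fixes X :: "complex set" and M :: "nat \<Rightarrow> real"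
  assumes "perfect_set X" and "compact X"
    and "weight_sequence M" and "nonanalytic M"
  shows "(\<forall>\<phi>. \<phi> \<in> D_infinity X \<and> \<phi> ` X \<subseteq> X \<and>
            limsup (\<lambda>k. ereal (root k (sup_norm X (higher_deriv_within X k \<phi>) / fact k))) < \<infinity> \<and>
            sup_norm X (deriv_within X \<phi>) < 1
          \<longrightarrow> induces_endomorphism X M \<phi>)
       \<and> (\<forall>\<phi>. \<phi> \<in> D_infinity X \<and> \<phi> ` X \<subseteq> X \<and>
            limsup (\<lambda>k. ereal (root k (sup_norm X (higher_deriv_within X k \<phi>) / fact k))) < \<infinity> \<and>
            (\<exists>B>0. \<forall>m n. 1 \<le> m \<and> m \<le> n \<longrightarrow>
               (M m / fact m) * (fact n / M n) \<le> B / real m ^ (n - m)) \<and>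
            bounded (range (\<lambda>k. sup_norm X (higher_deriv_within X k \<phi>) / fact k)) \<and>
            sup_norm X (deriv_within X \<phi>) \<le> 1
          \<longrightarrow> induces_endomorphism X M \<phi>)"
proof (intro conjI allI impI, goal_cases)
  case (1 \<phi>)
  then show ?case using induces_endomorphism_of_deriv_less_1[OF assms] by blast
next
  case (2 \<phi>)
  then obtain B where "B > 0" "\<forall>m n. 1 \<le> m \<and> m \<le> n \<longrightarrow>
      (M m / fact m) * (fact n / M n) \<le> B / real m ^ (n - m)"
    by blast
  with 2 show ?case using induces_endomorphism_of_deriv_le_1[OF assms, of \<phi> B] by blast
qed

end
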